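(* Every nine-triangle dissection $D$ of the unit square consisting of one cap having an entire side of the square as a side and an eight-step two-rail zig-zag in the complementary trapezoid satisfies $$R(D)>\frac1{3500}.$$ Here the triangle areas are arbitrary positive numbers and all $2^8=256$ direction sequences of the zig-zag are allowed; no balance condition (equal numbers of steps on the two rails) and no two-level condition (only two distinct area values) is imposed.
   Context: A dissection of the unit square into $n$ triangles is a collection of $n$ nondegenerate (positive-area) closed triangles with pairwise disjoint interiors whose union is the square; T-junctions are allowed. If $D$ has triangle areas $a_1,\dots,a_n$, its area range is $R(D)=\max_i a_i-\min_i a_i$. Single-cap two-rail family (up to a symmetry of the square). Let $P=(0,0)$, $Q=(1,0)$, $T=(1,1)$, $S=(0,1)$. The cap is the triangle $STR_c$ with $R_c=(1,1-2c)$, where $c\in(0,1/2)$ is its area. The complementary trapezoid $PQR_cS$ has a lower rail, the segment $PQ$, and an upper rail, the segment $SR_c$. An eight-step two-rail zig-zag with direction sequence $s=(s_1,\dots,s_8)\in\{-1,+1\}^8$ is a cutting of this trapezoid into eight triangles of the following form: start with $p_0=P$ on the lower rail and $u_0=S$ on the upper rail; at step $i$, if $s_i=-1$ choose $p_i$ on the lower rail strictly beyond $p_{i-1}$ in the direction of $Q$, put $u_i=u_{i-1}$, and the $i$-th triangle is $p_{i-1}p_iu_{i-1}$; if $s_i=+1$ choose $u_i$ on the upper rail strictly beyond $u_{i-1}$ in the direction of $R_c$, put $p_i=p_{i-1}$, and the $i$-th triangle is $p_{i-1}u_{i-1}u_i$; the zig-zag must end with $p_8=Q$ and $u_8=R_c$.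 The nine triangles of the dissection are the cap and these eight triangles. *)

theory Defs
  imports "HOL-Analysis.Analysis"
begin

definition pt :: "real \<Rightarrow> real \<Rightarrow> real^2" where
  "pt x y = vector [x, y]"

definition unit_square :: "(real^2) set" where
  "unit_square = cbox (pt 0 0) (pt 1 1)"

definition triangle :: "real^2 \<Rightarrow> real^2 \<Rightarrow> real^2 \<Rightarrow> (real^2) set" where
  "triangle a b c = convex hull {a, b, c}"

definition nondegenerate_triangle :: "(real^2) set \<Rightarrow> bool" where
  "nondegenerate_triangle T \<longleftrightarrow> (\<exists>a b c. T = triangle a b c) \<and> measure lborel T > 0"

definition dissection :: "nat \<Rightarrow> (real^2) set set \<Rightarrow> bool" where
  "dissection n D \<longleftrightarrow>
     finite D \<and> card D = n \<and>
     (\<forall>T\<in>D. nondegenerate_triangle T) \<and>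
     (\<forall>T\<in>D. \<forall>T'\<in>D. T \<noteq> T' \<longrightarrow> interior T \<inter> interior T' = {}) \<and>
     \<Union>D = unit_square"

definition area_range :: "(real^2) set set \<Rightarrow> real" where
  "area_range D = Max (measure lborel ` D) - Min (measure lborel ` D)"

definition square_symmetry :: "(real^2 \<Rightarrow> real^2) \<Rightarrow> bool" where
  "square_symmetry g \<longleftrightarrow>
     (\<forall>x y. dist (g x) (g y) = dist x y) \<and> g ` unit_square = unit_square"

definition cap_vertex :: "real \<Rightarrow> real^2" where
  "cap_vertex c = pt 1 (1 - 2 * c)"

definition cap :: "real \<Rightarrow> (real^2) set" where
  "cap c = triangle (pt 0 1) (pt 1 1) (cap_vertex c)"

lemma area_cap: "0 \<le> c \<Longrightarrow> measure lborel (cap c) = c"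
  unfolding cap_def triangle_def by (simp add: content_triangle pt_def cap_vertex_def)

(* For x on a rail ending at e: y lies on the same rail, strictly beyond x in the direction of e.
   No such y exists once x = e. *)
definition strictly_beyond :: "real^2 \<Rightarrow> real^2 \<Rightarrow> real^2 \<Rightarrow> bool" where
  "strictly_beyond e x y \<longleftrightarrow> y \<in> closed_segment x e \<and> y \<noteq> x"

definition zigzag :: "real \<Rightarrow> nat \<Rightarrow> (nat \<Rightarrow> int) \<Rightarrow> (nat \<Rightarrow> real^2) \<Rightarrow> (nat \<Rightarrow> real^2) \<Rightarrow> bool" where
  "zigzag c n s p u \<longleftrightarrow>
     (\<forall>i\<in>{1..n}. s i \<in> {-1, 1}) \<and>
     p 0 = pt 0 0 \<and> u 0 = pt 0 1 \<and>
     (\<forall>i\<in>{1..n}.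
        (s i = -1 \<longrightarrow> strictly_beyond (pt 1 0) (p (i - 1)) (p i) \<and> u i = u (i - 1)) \<and>
        (s i = 1 \<longrightarrow> strictly_beyond (cap_vertex c) (u (i - 1)) (u i) \<and> p i = p (i - 1))) \<and>
     p n = pt 1 0 \<and> u n = cap_vertex c"

definition zigzag_triangle ::
  "(nat \<Rightarrow> int) \<Rightarrow> (nat \<Rightarrow> real^2) \<Rightarrow> (nat \<Rightarrow> real^2) \<Rightarrow> nat \<Rightarrow> (real^2) set" where
  "zigzag_triangle s p u i =
     (if s i = -1 then triangle (p (i - 1)) (p i) (u (i - 1))
      else triangle (p (i - 1)) (u (i - 1)) (u i))"

(* The cap has the side from (0,1) to (1,1) and third vertex on the side x = 1; the other
   positions of a cap in the square arise by applying a symmetry g. *)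
definition single_cap_two_rail :: "nat \<Rightarrow> (real^2) set set \<Rightarrow> bool" where
  "single_cap_two_rail n D \<longleftrightarrow>
     (\<exists>g c s p u. square_symmetry g \<and> 0 < c \<and> c < 1/2 \<and> zigzag c n s p u \<and>
        D = (\<lambda>T. g ` T) ` insert (cap c) (zigzag_triangle s p u ` {1..n}))"

end

theory Submission
  imports Defs
begin

text \<open>
  Let \<open>x\<^sub>k\<close>, \<open>y\<^sub>k\<close> be the first coordinates of \<open>p\<^sub>k\<close>, \<open>u\<^sub>k\<close>, and put
  \<open>X\<^sub>k = 1 - 2 c x\<^sub>k\<close>, \<open>Y\<^sub>k = 1 - 2 c y\<^sub>k\<close>. A step of area \<open>a\<^sub>k\<close> changes only one of
  \<open>X\<close>, \<open>Y\<close> and lowers the product \<open>X Y\<close> by \<open>4 c a\<^sub>k\<close>, so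
  \<open>X\<^sub>k Y\<^sub>k = P\<^sub>k = 1 - 4 c (a\<^sub>1 + \<dots> + a\<^sub>k)\<close>. With \<open>L\<close> the set of lower steps, the end condition
  \<open>X\<^sub>8 = 1 - 2 c\<close> becomes \<open>(\<Sum>k\<in>L. ln P\<^sub>k - ln P\<^sub>k\<^sub>-\<^sub>1) = ln (1 - 2 c)\<close>.
  If all nine areas were \<open>1 / 9\<close>, this would say that the product of
  \<open>(81 - 4 k) / (85 - 4 k)\<close> over \<open>k \<in> L\<close> is \<open>7 / 9\<close>, which fails for each of the 256 sets \<open>L\<close>.
  A first-order expansion at equal areas, with an explicit error bound, shows that an area range of
  at most \<open>1 / 3500\<close> cannot close the gap; the final comparison is a finite integer computation.
  The margin is small: to first order, \<open>L = {2, 3, 5, 8}\<close> and its complement allow a range of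
  about \<open>1 / 3074\<close>.
\<close>

section \<open>Integer certificate for all sets of lower steps\<close>

text \<open>
  \<open>slope k\<close> is \<open>10\<^sup>5 \<cdot> 36 / (81 - 4 k)\<close> rounded to an integer, except for the irrelevant
  value at \<open>0\<close>; \<open>log_weight k i\<close> is \<open>- 10\<^sup>5\<close> times the partial derivative of \<open>ln P\<^sub>k\<close> in the
  \<open>i\<close>-th area at equal areas, index \<open>0\<close> being the cap. Likewise \<open>257143\<close> approximates
  \<open>10\<^sup>5 \<cdot> 18 / 7\<close>, which comes from \<open>ln (1 - 2 c)\<close>.
\<close>

definition slope :: "nat \<Rightarrow> int" where
  "slope k = [0, 46753, 49315, 52174, 55385, 59016, 63158, 67925, 73469] ! k"

definition log_weight :: "nat \<Rightarrow> nat \<Rightarrow> int" where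
  "log_weight k i = slope k * (if i = 0 then int k else if i \<le> k then 1 else 0)"

definition gradient :: "nat set \<Rightarrow> nat \<Rightarrow> int" where
  "gradient L i =
     (\<Sum>k\<in>L. log_weight (k - 1) i - log_weight k i) + (if i = 0 then 257143 else 0)"

text \<open>For nine entries this is \<open>9\<close> times the total absolute deviation from the
  mean; the factor keeps it integral.\<close>

definition spread :: "int list \<Rightarrow> int" where
  "spread g = (\<Sum>x\<leftarrow>g. \<bar>9 * x - sum_list g\<bar>)"

text \<open>
  Here \<open>63 \<cdot> 10\<^sup>8 = 2 \<cdot> 3500 \<cdot> 9 \<cdot> 10\<^sup>5\<close> collects the range, the factor \<open>9\<close> in \<open>spread\<close> and
  the scaling of the weights; \<open>190000\<close> covers the error \<open>2.92 \<cdot> 10\<^sup>-\<^sup>5\<close> of the linearization.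
\<close>

definition separated :: "int \<Rightarrow> int \<Rightarrow> int \<Rightarrow> bool" where
  "separated N M d \<longleftrightarrow> max N M * (d + 190000) < 6300000000 * \<bar>N - M\<bar>"

text \<open>
  The recursion shares the products and sums of a common prefix between subsets; evaluating each of
  the 256 subsets separately is much slower.
\<close>

fun subsets_separated :: "nat list \<Rightarrow> int \<Rightarrow> int \<Rightarrow> int list \<Rightarrow> bool" where
  "subsets_separated [] N M g \<longleftrightarrow> separated N M (spread g)"
| "subsets_separated (k # ks) N M g \<longleftrightarrow>
     subsets_separated ks N M g \<and>
     subsets_separated ks (N * (81 - 4 * int k)) (M * (85 - 4 * int k))
       (map2 (+) g (map (\<lambda>i. log_weight (k - 1) i - log_weight k i) [0..<9]))"

text \<open>Choosing \<open>k\<close> multiplies \<open>N\<close> and \<open>M\<close> by its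
  factors and adds its weights to \<open>f\<close>, so the induction generalizes these
  accumulators.\<close>

lemma subsets_separatedD:
  assumes "subsets_separated ks N M (map f [0..<9])" "distinct ks" "L \<subseteq> set ks"
  shows "separated (N * (\<Prod>k\<in>L. 81 - 4 * int k)) (M * (\<Prod>k\<in>L. 85 - 4 * int k))
    (spread (map (\<lambda>i. (\<Sum>k\<in>L. log_weight (k - 1) i - log_weight k i) + f i) [0..<9]))"
  using assms
proof (induction ks arbitrary: N M f L)
  case Nil
  then show ?case by simp
next
  case (Cons k ks)
  show ?case
  proof (cases "k \<in> L")
    case False
    then show ?thesis using Cons by (intro Cons.IH) auto
  next
    case True
    define L' where "L' = L - {k}"
    have L: "L = insert k L'" "k \<notin> L'" "finite L'" "L' \<subseteq> set ks"
      using True Cons.prems(3) finite_subset[OF Cons.prems(3)] by (auto simp: L'_def)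
    have "subsets_separated ks (N * (81 - 4 * int k)) (M * (85 - 4 * int k))
       (map (\<lambda>i. f i + (log_weight (k - 1) i - log_weight k i)) [0..<9])"
      using Cons.prems(1) by (simp only: subsets_separated.simps map2_map_map)
    from Cons.IH[OF this _ L(4)] Cons.prems(2) L(2,3) show ?thesis
      unfolding L(1)
      by (simp only: distinct.simps sum.insert prod.insert if_False ac_simps simp_thms)
  qed
qed

lemma separated_gradient:
  assumes "L \<subseteq> {1..8}"
  shows "separated (9 * (\<Prod>k\<in>L. 81 - 4 * int k)) (7 * (\<Prod>k\<in>L. 85 - 4 * int k))
    (spread (map (gradient L) [0..<9]))"
  unfolding gradient_def
proof (rule subsets_separatedD)
  \<comment> \<open>Starting at \<open>9\<close> and \<open>7\<close> makes equality of the two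
    final products mean that the product over \<open>L\<close> is 7 / 9.\<close>
  show "subsets_separated [1..<9] 9 7 (map (\<lambda>i. if i = 0 then 257143 else 0) [0..<9])"
    by code_simp
qed (use assms in auto)

section \<open>Inequalities for logarithms and linear forms\<close>

text \<open>Apply ln z \<le> z - 1 at y / x and at x / y. An integer gap thus bounds a logarithm
  from below without evaluating it.\<close>

lemma abs_ln_divide_ge:
  fixes x y :: real
  assumes "0 < x" "0 < y"
  shows "\<bar>x - y\<bar> \<le> max x y * \<bar>ln (x / y)\<bar>"
proof -
  have *: "x - y \<le> x * ln (x / y)" if "0 < x" "0 < y" for x y :: real
  proof -
    have "ln (y / x) \<le> y / x - 1"
      using that by (intro ln_le_minus_one) simp
    then have "x * ln (y / x) \<le> x * (y / x - 1)"
      using that by (intro mult_left_mono) auto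
    then show ?thesis
      using that by (simp add: ln_div algebra_simps)
  qed
  have "x - y \<le> max x y * \<bar>ln (x / y)\<bar>"
    using *[OF assms] assms
    by (smt (verit) mult_mono max.cobounded1 abs_ge_zero abs_ge_self mult_left_mono mult_right_mono)
  moreover have "y - x \<le> max x y * \<bar>ln (x / y)\<bar>"
  proof -
    have "\<bar>ln (y / x)\<bar> = \<bar>ln (x / y)\<bar>"
      using assms by (simp add: ln_div abs_minus_commute)
    then show ?thesis
      using *[OF assms(2,1)] assms
      by (smt (verit) mult_mono max.cobounded2 abs_ge_zero abs_ge_self mult_left_mono mult_right_mono)
  qed
  ultimately show ?thesis by linarith
qed

text \<open>Apply ln z \<le> z - 1 at (b + d) / b and at its reciprocal; only the latter leaves an
  error, d^2 / (b (b + d)).\<close>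

lemma abs_ln_sub_le:
  fixes b d t :: real
  assumes "0 < b" "\<bar>d\<bar> \<le> t" "t < b"
  shows "\<bar>ln (b + d) - ln b - d / b\<bar> \<le> t\<^sup>2 / (b * (b - t))"
proof -
  have pos: "0 < b - t" "b - t \<le> b + d" "0 < b + d" using assms by auto
  have "ln ((b + d) / b) \<le> (b + d) / b - 1"
    using assms pos by (intro ln_le_minus_one) simp
  then have upper: "ln (b + d) - ln b \<le> d / b"
    using assms pos by (simp add: ln_div field_simps)
  have "ln (b / (b + d)) \<le> b / (b + d) - 1"
    using assms pos by (intro ln_le_minus_one) simp
  also have "\<dots> = d\<^sup>2 / (b * (b + d)) - d / b"
  proof -
    have "b \<noteq> 0" "b + d \<noteq> 0"
      using assms(1) pos(3) by auto
    then show ?thesis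
      by (simp add: divide_simps) (simp add: algebra_simps power2_eq_square)
  qed
  also have "d\<^sup>2 / (b * (b + d)) \<le> t\<^sup>2 / (b * (b - t))"
  proof (intro frac_le mult_left_mono)
    show "d\<^sup>2 \<le> t\<^sup>2"
      using assms(2) power_mono[of "\<bar>d\<bar>" t 2] by simp
  qed (use assms pos in auto)
  finally have "ln b - ln (b + d) \<le> t\<^sup>2 / (b * (b - t)) - d / b"
    using assms pos by (simp add: ln_div)
  then show ?thesis using upper by linarith
qed

text \<open>Since \<delta> sums to 0, \<open>g\<close> may be centred at its mean; the centred
  \<open>g\<close> sums to 0, so \<delta> may be centred at its midrange \<open>m\<close>, from
  which it deviates by at most \<epsilon> / 2.\<close>

lemma abs_sum_le_spread:
  fixes g \<delta> :: "'a \<Rightarrow> real"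
  assumes "finite A" "A \<noteq> {}" "sum \<delta> A = 0"
    and osc: "\<And>i j. i \<in> A \<Longrightarrow> j \<in> A \<Longrightarrow> \<delta> i - \<delta> j \<le> \<epsilon>"
  shows "\<bar>\<Sum>i\<in>A. g i * \<delta> i\<bar> \<le> \<epsilon> / 2 * (\<Sum>i\<in>A. \<bar>g i - sum g A / card A\<bar>)"
proof -
  define \<mu> where "\<mu> = sum g A / card A"
  define m where "m = (Max (\<delta> ` A) + Min (\<delta> ` A)) / 2"
  have "Max (\<delta> ` A) \<in> \<delta> ` A" "Min (\<delta> ` A) \<in> \<delta> ` A"
    using assms by simp_all
  then have "Max (\<delta> ` A) - Min (\<delta> ` A) \<le> \<epsilon>"
    using osc by fastforce
  moreover have "\<delta> i \<le> Max (\<delta> ` A)" "Min (\<delta> ` A) \<le> \<delta> i" if "i \<in> A" for i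
    using that assms(1) by simp_all
  ultimately have m: "\<bar>\<delta> i - m\<bar> \<le> \<epsilon> / 2" if "i \<in> A" for i
    unfolding m_def abs_le_iff using that by (simp add: field_simps) (smt (verit))
  have "(\<Sum>i\<in>A. g i - \<mu>) = 0"
    using assms(1,2) by (simp add: \<mu>_def sum_subtractf)
  then have "(\<Sum>i\<in>A. g i * \<delta> i) = (\<Sum>i\<in>A. (g i - \<mu>) * (\<delta> i - m))"
    using assms(3)
    by (simp add: algebra_simps sum.distrib sum_subtractf flip: sum_distrib_left sum_distrib_right)
  also have "\<bar>\<dots>\<bar> \<le> (\<Sum>i\<in>A. \<epsilon> / 2 * \<bar>g i - \<mu>\<bar>)"
  proof (intro order.trans[OF sum_abs] sum_mono)
    fix i assume "i \<in> A"
    then show "\<bar>(g i - \<mu>) * (\<delta> i - m)\<bar> \<le> \<epsilon> / 2 * \<bar>g i - \<mu>\<bar>"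
      unfolding abs_mult using mult_left_mono[OF m, of i "\<bar>g i - \<mu>\<bar>"]
      by (simp only: mult.commute abs_ge_zero)
  qed
  finally show ?thesis
    by (simp add: \<mu>_def sum_distrib_left)
qed

section \<open>Linearization near equal areas\<close>

text \<open>\<open>\<delta> i\<close> is the deviation of the \<open>i\<close>-th area from \<open>1 / 9\<close>, with the cap at index \<open>0\<close>.\<close>

locale near_equal_areas =
  fixes \<delta> :: "nat \<Rightarrow> real"
  assumes sum_zero: "sum \<delta> {..<9} = 0"
    and osc: "\<And>i j. i < 9 \<Longrightarrow> j < 9 \<Longrightarrow> \<delta> i - \<delta> j \<le> 1 / 3500"
begin

text \<open>This is \<open>abs_sum_le_spread\<close> for the indicator of \<open>B\<close>, whose
  total deviation from its mean is 2 |B| (9 - |B|) / 9.\<close>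

lemma abs_sum_subset_le:
  assumes "B \<subseteq> {..<9}"
  shows "\<bar>sum \<delta> B\<bar> \<le> real (card B) * (9 - real (card B)) / 31500"
proof -
  define g :: "nat \<Rightarrow> real" where "g i = (if i \<in> B then 1 else 0)" for i
  have fin: "finite B" and int: "{..<9} \<inter> B = B" and le: "card B \<le> 9"
    using assms card_mono[OF _ assms] by (auto intro: finite_subset)
  have "sum \<delta> B = (\<Sum>i<9. g i * \<delta> i)"
    using sum.inter_restrict[of "{..<9}" \<delta> B] int
    by (simp add: g_def if_distribR if_distrib[of "\<lambda>x. x * _"] cong: if_cong)
  also have "\<bar>\<dots>\<bar> \<le> 1 / 3500 / 2 * (\<Sum>i<9. \<bar>g i - sum g {..<9} / card {..<9::nat}\<bar>)"
    using sum_zero osc by (intro abs_sum_le_spread) (auto simp: lessThan_empty_iff)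
  also have "sum g {..<9} = card B"
    using int by (simp add: g_def sum.If_cases)
  also have "(\<Sum>i<9. \<bar>g i - card B / card {..<9::nat}\<bar>) = 
     (\<Sum>i<9. if i \<in> B then 1 - card B / 9 else card B / 9)"
    using le by (intro sum.cong) (auto simp: g_def)
  also have "\<dots> = 2 * real (card B) * (9 - real (card B)) / 9"
    using int le assms fin
    by (simp add: sum.If_cases Compl_eq[symmetric] Diff_eq[symmetric] card_Diff_subset
        of_nat_diff field_simps)
  finally show ?thesis by (simp add: mult.commute)
qed

text \<open>The product \<open>P\<^sub>k\<close> for cap area 1 / 9 + \<delta> 0 and i-th area 1 / 9
  + \<delta> i.\<close>

definition remainder :: "nat \<Rightarrow> real" where
  "remainder k = 1 - 4 * (1 / 9 + \<delta> 0) * (real k / 9 + sum \<delta> {1..k})"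

text \<open>Around the equal-area value \<open>b\<close> there are three errors: the second-order
  term of ln, the bilinear term \<gamma> D and the rounding of \<open>slope\<close>.\<close>

lemma ln_remainder:
  assumes "k \<le> 8"
  shows "0 < remainder k"
    and "\<bar>ln (remainder k) - ln ((81 - 4 * real k) / 81)
           + (\<Sum>i<9. log_weight k i * \<delta> i) / 100000\<bar> \<le> 44 / 100000000 * real k"
proof -
  define \<gamma> D v where "\<gamma> = \<delta> 0" and "D = sum \<delta> {1..k}" and "v = real k * \<gamma> + D"
  define b where "b = (81 - 4 * real k) / 81"
  have \<gamma>: "\<bar>\<gamma>\<bar> \<le> 8 / 31500"
    using abs_sum_subset_le[of "{0}"] by (simp add: \<gamma>_def)
  have D: "\<bar>D\<bar> \<le> real k * (9 - real k) / 31500"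
    using abs_sum_subset_le[of "{1..k}"] assms by (simp add: D_def subset_iff)
  have v: "\<bar>v\<bar> \<le> real k * (17 - real k) / 31500"
  proof -
    have "\<bar>v\<bar> \<le> k * \<bar>\<gamma>\<bar> + \<bar>D\<bar>"
      unfolding v_def by (metis abs_mult abs_of_nat abs_triangle_ineq)
    also have "k * \<bar>\<gamma>\<bar> \<le> k * (8 / 31500)"
      using \<gamma> by (intro mult_left_mono) auto
    finally show ?thesis
      using D by (simp add: algebra_simps)
  qed
  have W: "\<bar>\<gamma> * D\<bar> \<le> 8 * (real k * (9 - real k)) / 31500\<^sup>2"
    using mult_mono[OF \<gamma> D] by (simp add: abs_mult power2_eq_square)
  define d where "d = - (4 / 9 * v + 4 * (\<gamma> * D))"
  define t where "t = 4 / 9 * (real k * (17 - real k) / 31500)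
      + 4 * (8 * (real k * (9 - real k)) / 31500\<^sup>2)"
  have P: "remainder k = b + d"
    unfolding remainder_def b_def d_def v_def \<gamma>_def D_def
    by (simp add: diff_divide_distrib algebra_simps)
  have d: "\<bar>d\<bar> \<le> t"
    using v W unfolding d_def t_def by (simp only: abs_le_iff) linarith
  have lin: "(\<Sum>i<9. log_weight k i * \<delta> i) = slope k * v"
  proof -
    have "(\<Sum>i<9. log_weight k i * \<delta> i) =
        log_weight k 0 * \<delta> 0 + (\<Sum>i=1..8. log_weight k i * \<delta> i)"
      by (simp add: lessThan_nat_numeral sum.atLeast1_atMost_eq numeral_eq_Suc lessThan_Suc add.commute)
    also have "(\<Sum>i=1..8. log_weight k i * \<delta> i) = (\<Sum>i=1..k. slope k * \<delta> i)"
      using assms by (intro sum.mono_neutral_cong_right) (auto simp: log_weight_def)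
    finally show ?thesis
      by (simp add: log_weight_def v_def \<gamma>_def D_def algebra_simps sum_distrib_left)
  qed
  have k: "k \<in> {0,1,2,3,4,5,6,7,8}"
    using assms by auto
  have tb: "0 < b" "t < b" 
     using k unfolding t_def b_def by auto
  then show "0 < remainder k"
    using P d by linarith
  have r: "\<bar>v * (slope k / 100000 - 4 / 9 / b)\<bar>
      \<le> real k * (17 - real k) / 31500 * (6 / 1000000)"
  \<comment> \<open>For \<open>k = 0\<close> also \<open>v = 0\<close>, so the placeholder
    \<open>slope 0\<close> is harmless.\<close>
  proof (cases "k = 0")
    case True
    then show ?thesis using v by simp
  next
    case False
    then have "\<bar>slope k / 100000 - 4 / 9 / b\<bar> \<le> 6 / 1000000"
      using k unfolding b_def slope_def by auto
    from mult_mono[OF v this] show ?thesis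
      using assms unfolding abs_mult by simp
  qed
  have "\<bar>4 * (\<gamma> * D) / b\<bar> \<le> 4 * (8 * (real k * (9 - real k)) / 31500\<^sup>2) / b"
    using divide_right_mono[OF mult_left_mono[OF W, of 4], of b] tb(1)
    by (simp only: abs_mult abs_divide abs_of_pos abs_numeral)
  moreover have "\<bar>ln (b + d) - ln b - d / b\<bar> \<le> t\<^sup>2 / (b * (b - t))"
    using tb d by (intro abs_ln_sub_le)
  moreover have "t\<^sup>2 / (b * (b - t)) + 4 * (8 * (real k * (9 - real k)) / 31500\<^sup>2) / b
      + real k * (17 - real k) / 31500 * (6 / 1000000) \<le> 44 / 100000000 * real k"
    using k unfolding t_def b_def by (auto simp: power2_eq_square)
  moreover have "ln (b + d) - ln b + slope k * v / 100000 =
     (ln (b + d) - ln b - d / b) - 4 * (\<gamma> * D) / b + v * (slope k / 100000 - 4 / 9 / b)"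
    using tb by (simp add: d_def field_simps)
  ultimately show "\<bar>ln (remainder k) - ln ((81 - 4 * real k) / 81)
      + (\<Sum>i<9. log_weight k i * \<delta> i) / 100000\<bar> \<le> 44 / 100000000 * real k"
    using r unfolding P lin b_def[symmetric] by linarith
qed

text \<open>The target is ln (1 - 2 c) at c = 1 / 9 + \<delta> 0; the slack above the quadratic
  error pays for rounding 18 / 7.\<close>

lemma ln_rail_end:
  "\<bar>ln (7 / 9 - 2 * \<delta> 0) - ln (7 / 9) + 257143 / 100000 * \<delta> 0\<bar> \<le> 1 / 1000000"
proof -
  have \<gamma>: "\<bar>\<delta> 0\<bar> \<le> 8 / 31500"
    using abs_sum_subset_le[of "{0}"] by simp
  have "\<bar>ln (7 / 9 + - 2 * \<delta> 0) - ln (7 / 9) - (- 2 * \<delta> 0) / (7 / 9)\<bar>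
      \<le> (16 / 31500)\<^sup>2 / (7 / 9 * (7 / 9 - 16 / 31500))"
    using \<gamma> by (intro abs_ln_sub_le) (auto simp: abs_mult)
  also have "\<dots> \<le> 9 / 10000000"
    by (simp add: power2_eq_square)
  finally have "\<bar>ln (7 / 9 - 2 * \<delta> 0) - ln (7 / 9) + 18 / 7 * \<delta> 0\<bar> \<le> 9 / 10000000"
    by simp
  with \<gamma> show ?thesis
    unfolding abs_le_iff by linarith
qed

text \<open>Otherwise ln (N / M), the defect at equal areas, would be -G / 10^5 up to the
  linearization error, too small for the gap certified by \<open>separated_gradient\<close>.\<close>

lemma log_sum_ne:
  assumes "L \<subseteq> {1..8}"
  shows "(\<Sum>k\<in>L. ln (remainder k) - ln (remainder (k - 1))) \<noteq> ln (7 / 9 - 2 * \<delta> 0)"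
proof
  assume eq: "(\<Sum>k\<in>L. ln (remainder k) - ln (remainder (k - 1))) = ln (7 / 9 - 2 * \<delta> 0)"
  have fin: "finite L" and L: "\<And>k. k \<in> L \<Longrightarrow> 1 \<le> k \<and> k \<le> 8"
    using assms finite_subset[OF assms] by auto
  define N M where "N = 9 * (\<Prod>k\<in>L. 81 - 4 * int k)" and "M = 7 * (\<Prod>k\<in>L. 85 - 4 * int k)"
  define G where "G = (\<Sum>i<9. gradient L i * \<delta> i)"
  define T where "T = (\<Sum>i<9. \<bar>9 * gradient L i - sum (gradient L) {..<9}\<bar>)"
  have spread: "spread (map (gradient L) [0..<9]) = T"
    by (simp add: spread_def T_def comp_def interv_sum_list_conv_sum_set_nat atLeast0LessThan)
  have pos: "0 < N" "0 < M"
    unfolding N_def M_def using L by (fastforce intro!: mult_pos_pos prod_pos)+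
  have G: "\<bar>G\<bar> \<le> T / 63000"
  proof -
    have "\<bar>G\<bar> \<le> 1 / 3500 / 2 *
        (\<Sum>i<9. \<bar>real_of_int (gradient L i) - (\<Sum>i<9. real_of_int (gradient L i)) / card {..<9::nat}\<bar>)"
      unfolding G_def using sum_zero osc by (intro abs_sum_le_spread) (auto simp: lessThan_empty_iff)
    also have "\<dots> = 1 / 7000 * (\<Sum>i<9. \<bar>9 * gradient L i - sum (gradient L) {..<9}\<bar> / 9)"
      by (intro arg_cong2[of _ _ _ _ "(*)"] sum.cong) (auto simp: field_simps)
    also have "\<dots> = T / 63000"
      by (simp add: T_def flip: sum_divide_distrib)
    finally show ?thesis .
  qed
  define e where "e k = ln (remainder k) - ln ((81 - 4 * real k) / 81)
           + (\<Sum>i<9. log_weight k i * \<delta> i) / 100000" for k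
  have e: "\<bar>e k\<bar> \<le> 44 / 100000000 * real k" if "k \<le> 8" for k
    unfolding e_def by (rule ln_remainder(2)[OF that])
  \<comment> \<open>The odd numbers 2 k - 1 for k = 1, ..., 8 sum to 64, and 64 * 44 = 2816.\<close>
  have err: "\<bar>\<Sum>k\<in>L. e k - e (k - 1)\<bar> \<le> 282 / 10000000"
  proof -
    have "\<bar>\<Sum>k\<in>L. e k - e (k - 1)\<bar> \<le> (\<Sum>k\<in>L. 44 / 100000000 * (2 * real k - 1))"
    proof (intro order.trans[OF sum_abs] sum_mono)
      fix k assume "k \<in> L"
      then have "1 \<le> k" "k \<le> 8" using L by auto
      then have "\<bar>e k\<bar> \<le> 44 / 100000000 * real k" "\<bar>e (k - 1)\<bar> \<le> 44 / 100000000 * (real k - 1)"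
        using e[of k] e[of "k - 1"] by (simp_all add: of_nat_diff)
      then show "\<bar>e k - e (k - 1)\<bar> \<le> 44 / 100000000 * (2 * real k - 1)"
        by argo
    qed
    also have "\<dots> \<le> (\<Sum>k=1..8. 44 / 100000000 * (2 * real k - 1))"
      using assms by (intro sum_mono2) auto
    also have "\<dots> \<le> 282 / 10000000"
      by (simp add: numeral_eq_Suc)
    finally show ?thesis .
  qed
  have lnNM: "ln (N / M) =
      (\<Sum>k\<in>L. ln ((81 - 4 * real k) / 81) - ln ((81 - 4 * real (k - 1)) / 81)) - ln (7 / 9)"
  proof -
    have "ln (\<Prod>k\<in>L. 81 - 4 * real k) = (\<Sum>k\<in>L. ln (81 - 4 * real k))"
         "ln (\<Prod>k\<in>L. 85 - 4 * real k) = (\<Sum>k\<in>L. ln (85 - 4 * real k))"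
      using L fin by (fastforce intro!: ln_prod)+
    moreover have "0 < (\<Prod>k\<in>L. 81 - 4 * real k)" "0 < (\<Prod>k\<in>L. 85 - 4 * real k)"
      using L by (fastforce intro!: prod_pos)+
    moreover have "(\<Sum>k\<in>L. ln ((81 - 4 * real k) / 81) - ln ((81 - 4 * real (k - 1)) / 81)) =
       (\<Sum>k\<in>L. ln (81 - 4 * real k) - ln (85 - 4 * real k))"
      using L by (intro sum.cong) (fastforce simp: ln_div of_nat_diff)+
    ultimately show ?thesis
      by (simp add: N_def M_def ln_div ln_mult sum_subtractf)
  qed
  have "G = (\<Sum>k\<in>L. (\<Sum>i<9. log_weight (k - 1) i * \<delta> i) - (\<Sum>i<9. log_weight k i * \<delta> i))
       + 257143 * \<delta> 0"
  proof -
    have "G = (\<Sum>i<9. (\<Sum>k\<in>L. log_weight (k - 1) i * \<delta> i - log_weight k i * \<delta> i))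
       + (\<Sum>i<9. (if i = 0 then 257143 * \<delta> i else 0))"
      unfolding G_def sum.distrib[symmetric]
      by (intro sum.cong) (auto simp: gradient_def algebra_simps sum_distrib_left)
    then show ?thesis
      by (subst (asm) sum.swap) (simp add: sum_subtractf)
  qed
  moreover have "(\<Sum>k\<in>L. e k - e (k - 1)) =
      (\<Sum>k\<in>L. ln (remainder k) - ln (remainder (k - 1))) 
      - (\<Sum>k\<in>L. ln ((81 - 4 * real k) / 81) - ln ((81 - 4 * real (k - 1)) / 81))
      - (\<Sum>k\<in>L. (\<Sum>i<9. log_weight (k - 1) i * \<delta> i) - (\<Sum>i<9. log_weight k i * \<delta> i)) / 100000"
    by (simp add: e_def sum.distrib sum_subtractf sum_divide_distrib algebra_simps diff_divide_distrib)
  \<comment> \<open>In units of 10^-7, the error is 282 from \<open>err\<close> plus 10 from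
    \<open>ln_rail_end\<close>.\<close>
  ultimately have "\<bar>ln (N / M)\<bar> \<le> \<bar>G\<bar> / 100000 + 292 / 10000000"
    using ln_rail_end err unfolding lnNM eq by linarith
  also have "\<dots> \<le> T / 6300000000 + 292 / 10000000"
    using G by simp
  also have "\<dots> \<le> (T + 190000) / 6300000000"
    by (simp add: field_simps)
  finally have "max (real_of_int N) M * \<bar>ln (N / M)\<bar>
      \<le> max (real_of_int N) M * ((T + 190000) / 6300000000)"
    using pos by (intro mult_left_mono) auto
  moreover have "\<bar>real_of_int N - M\<bar> \<le> max (real_of_int N) M * \<bar>ln (N / M)\<bar>"
    using pos by (intro abs_ln_divide_ge) auto
  ultimately have "\<bar>real_of_int N - M\<bar> \<le> max (real_of_int N) M * ((T + 190000) / 6300000000)"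
    by (rule order.trans[rotated])
  then have "6300000000 * \<bar>real_of_int N - M\<bar> \<le> max (real_of_int N) M * (T + 190000)"
    unfolding times_divide_eq_right by (subst (asm) pos_le_divide_eq) (simp_all add: mult.commute)
  then have "real_of_int (6300000000 * \<bar>N - M\<bar>) \<le> real_of_int (max N M * (T + 190000))"
    unfolding of_int_mult of_int_abs of_int_diff of_int_max of_int_add of_int_numeral .
  then have "6300000000 * \<bar>N - M\<bar> \<le> max N M * (T + 190000)"
    by (simp only: of_int_le_iff)
  moreover have "separated N M T"
    using separated_gradient[OF assms] by (simp only: N_def M_def spread)
  ultimately show False
    by (simp add: separated_def)
qed

end

section \<open>Isometries and the geometry of the two rails\<close>

text \<open>Subtracting \<open>f 0\<close> leaves an isometry fixing 0, hence an orthogonal map;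
  such maps and translations preserve Lebesgue measure.\<close>

lemma content_isometry_image:
  fixes f :: "real^'n::{finite,wellorder} \<Rightarrow> real^'n::{finite,wellorder}"
  assumes iso: "\<And>x y. dist (f x) (f y) = dist x y" and "compact S"
  shows "measure lborel (f ` S) = measure lborel S"
proof -
  define h where "h x = f x - f 0" for x
  have h: "orthogonal_transformation h"
    unfolding orthogonal_transformation_isometry
  proof (intro conjI allI)
    show "dist (h x) (h y) = dist x y" for x y
      using iso[of x y] by (simp add: h_def dist_norm)
  qed (simp add: h_def)
  have f: "f ` S = (+) (f 0) ` h ` S"
    by (auto simp: h_def image_image)
  have hS: "compact (h ` S)"
    using h \<open>compact S\<close>
    by (intro compact_continuous_image linear_continuous_on)
       (auto simp: orthogonal_transformation_linear linear_linear)
  have "compact (f ` S)"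
    unfolding f using hS by (rule compact_translation)
  then have "measure lborel (f ` S) = measure lebesgue (f ` S)"
    by (simp add: borel_compact)
  also have "\<dots> = measure lebesgue (h ` S)"
    unfolding f by (rule measure_translation)
  also have "\<dots> = measure lebesgue S"
    using h lmeasurable_compact[OF \<open>compact S\<close>] by (rule measure_orthogonal_image)
  also have "\<dots> = measure lborel S"
    using \<open>compact S\<close> by (simp add: borel_compact)
  finally show ?thesis .
qed

lemma pt_nth [simp]: "pt x y $ 1 = x" "pt x y $ 2 = y"
  by (simp_all add: pt_def)

text \<open>Both rails are graphs b + e x, with (b, e) = (0, 0) and (1, -2 c), so this serves both
  and reduces positions to first coordinates.\<close>

lemma strictly_beyond_on_graph:
  assumes "strictly_beyond (pt d (b + e * d)) (pt x (b + e * x)) q" "x \<le> d"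
  shows "q = pt (q $ 1) (b + e * q $ 1)" "x < q $ 1" "q $ 1 \<le> d"
proof -
  obtain t where t: "0 \<le> t" "t \<le> 1"
      "q = (1 - t) *\<^sub>R pt x (b + e * x) + t *\<^sub>R pt d (b + e * d)"
    and ne: "q \<noteq> pt x (b + e * x)"
    using assms unfolding strictly_beyond_def closed_segment_def by auto
  show q: "q = pt (q $ 1) (b + e * q $ 1)"
    unfolding t(3) by (simp add: vec_eq_iff forall_2 algebra_simps)
  have "q $ 1 - x = t * (d - x)" "d - q $ 1 = (1 - t) * (d - x)"
    unfolding t(3) by (simp_all add: algebra_simps)
  then have "0 \<le> q $ 1 - x" "0 \<le> d - q $ 1"
    using t(1,2) assms(2) by (simp_all only: mult_nonneg_nonneg diff_ge_0_iff_ge)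
  moreover have "q $ 1 \<noteq> x"
    using ne q by metis
  ultimately show "x < q $ 1" "q $ 1 \<le> d"
    by simp_all
qed

lemma zigzag_coordinates:
  assumes "zigzag c n s p u" "k \<le> n"
  shows "p k = pt (p k $ 1) 0 \<and> p k $ 1 \<le> 1 \<and>
         u k = pt (u k $ 1) (1 - 2 * c * u k $ 1) \<and> u k $ 1 \<le> 1"
  using \<open>k \<le> n\<close>
proof (induction k)
  case 0
  then show ?case using assms(1) by (simp add: zigzag_def)
next
  case (Suc k)
  then have IH: "p k = pt (p k $ 1) 0" "p k $ 1 \<le> 1"
      "u k = pt (u k $ 1) (1 - 2 * c * u k $ 1)" "u k $ 1 \<le> 1"
    by simp_all
  have "Suc k \<in> {1..n}"
    using Suc.prems by simp
  with assms(1) consider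
      "strictly_beyond (pt 1 0) (p k) (p (Suc k))" "u (Suc k) = u k"
    | "strictly_beyond (cap_vertex c) (u k) (u (Suc k))" "p (Suc k) = p k"
    unfolding zigzag_def by fastforce
  then show ?case
  proof cases
    case 1
    then show ?thesis
      using IH strictly_beyond_on_graph[of 1 0 0 "p k $ 1" "p (Suc k)"] by simp
  next
    case 2
    then show ?thesis
      using IH strictly_beyond_on_graph[of 1 1 "- 2 * c" "u k $ 1" "u (Suc k)"]
      by (simp add: cap_vertex_def)
  qed
qed

lemma measure_triangle:
  "measure lborel (triangle A B C) =
     \<bar>(C $ 1 - A $ 1) * (B $ 2 - A $ 2) - (B $ 1 - A $ 1) * (C $ 2 - A $ 2)\<bar> / 2"
  unfolding triangle_def by (rule content_triangle)

text \<open>X k * Y k / (4 c) is the area of the triangle formed by \<open>p k\<close>,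
  \<open>u k\<close> and the point (1 / (2 c), 0) where the extended rails meet; each step cuts its
  zig-zag triangle off this one.\<close>

lemma zigzag_step:
  assumes z: "zigzag c n s p u" and k: "k \<in> {1..n}" and c: "0 < c" "c < 1 / 2"
  defines "X \<equiv> \<lambda>k. 1 - 2 * c * p k $ 1" and "Y \<equiv> \<lambda>k. 1 - 2 * c * u k $ 1"
  shows "X k * Y k = X (k - 1) * Y (k - 1) - 4 * c * measure lborel (zigzag_triangle s p u k)"
    and "X k = X (k - 1) \<or> Y k = Y (k - 1)"
proof -
  obtain j where j: "k = Suc j" "Suc j \<le> n"
    using k by (cases k) auto
  define x y x' y' where "x = p j $ 1" and "y = u j $ 1" and "x' = p k $ 1" and "y' = u k $ 1"
  have old: "p j = pt x 0" "x \<le> 1" "u j = pt y (1 - 2 * c * y)" "y \<le> 1"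
    using zigzag_coordinates[OF z, of j] j by (simp_all add: x_def y_def)
  have new: "p k = pt x' 0" "u k = pt y' (1 - 2 * c * y')"
    using zigzag_coordinates[OF z, of k] j by (simp_all add: x'_def y'_def)
  have pos: "0 < 1 - 2 * c * t" if "t \<le> 1" for t
    using mult_left_mono[OF that, of "2 * c"] c by linarith
  have steps: "(s k = -1 \<longrightarrow> strictly_beyond (pt 1 0) (p j) (p k) \<and> u k = u j)"
      "(s k = 1 \<longrightarrow> strictly_beyond (cap_vertex c) (u j) (u k) \<and> p k = p j)"
      "s k = -1 \<or> s k = 1"
    using z k j unfolding zigzag_def by auto
  have "X k * Y k = X j * Y j - 4 * c * measure lborel (zigzag_triangle s p u k)
      \<and> (X k = X j \<or> Y k = Y j)"
  proof (cases "s k = -1")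
    case True
    then have "strictly_beyond (pt 1 0) (p j) (p k)" and u: "u k = u j"
      using steps by simp_all
    then have "x < x'"
      using old strictly_beyond_on_graph(2)[of 1 0 0 x "p k"] by (simp add: x'_def)
    moreover have "measure lborel (zigzag_triangle s p u k) =
        \<bar>(x' - x) * (1 - 2 * c * y)\<bar> / 2"
      using True by (simp add: zigzag_triangle_def measure_triangle j(1) old new[unfolded j(1)])
    ultimately have area:
      "measure lborel (zigzag_triangle s p u k) = (x' - x) * (1 - 2 * c * y) / 2"
      using pos[OF old(4)] by simp
    show ?thesis
      unfolding X_def Y_def area u by (simp add: field_simps flip: x_def y_def x'_def)
  next
    case False
    then have "strictly_beyond (cap_vertex c) (u j) (u k)" and p: "p k = p j"
      using steps by simp_all
    then have "y < y'"
      using old strictly_beyond_on_graph(2)[of 1 1 "- 2 * c" y "u k"]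
      by (simp add: y'_def cap_vertex_def)
    moreover have "measure lborel (zigzag_triangle s p u k) =
        \<bar>(y' - x) * (1 - 2 * c * y) - (y - x) * (1 - 2 * c * y')\<bar> / 2"
      using False by (simp add: zigzag_triangle_def measure_triangle j(1) old new[unfolded j(1)])
    moreover have "(y' - x) * (1 - 2 * c * y) - (y - x) * (1 - 2 * c * y')
         = (y' - y) * (1 - 2 * c * x)"
      by (simp add: algebra_simps)
    ultimately have area:
      "measure lborel (zigzag_triangle s p u k) = (y' - y) * (1 - 2 * c * x) / 2"
      using pos[OF old(2)] by simp
    show ?thesis
      unfolding X_def Y_def area p by (simp add: field_simps flip: x_def y_def y'_def)
  qed
  then show "X k * Y k = X (k - 1) * Y (k - 1) - 4 * c * measure lborel (zigzag_triangle s p u k)"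
    and "X k = X (k - 1) \<or> Y k = Y (k - 1)"
    by (simp_all add: j(1))
qed

section \<open>Lower bound for the area range\<close>

lemma diff_le_area_range:
  assumes "finite D" "T \<in> D" "T' \<in> D"
  shows "measure lborel T - measure lborel T' \<le> area_range D"
  unfolding area_range_def using assms by (intro diff_mono Max_ge Min_le) auto

text \<open>The bound in purely numerical form, with \<open>a 0\<close> the cap area
  \<open>c\<close>.\<close>

lemma two_rail_unequal_areas:
  fixes a X Y :: "nat \<Rightarrow> real"
  assumes init: "X 0 = 1" "Y 0 = 1"
    and final: "X 8 = 1 - 2 * a 0" "Y 8 = 1 - 2 * a 0"
    and pos: "\<And>k. k \<le> 8 \<Longrightarrow> 0 < X k" "\<And>k. k \<le> 8 \<Longrightarrow> 0 < Y k" "0 < a 0"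
    and prod: "\<And>k. k \<in> {1..8} \<Longrightarrow> X k * Y k = X (k - 1) * Y (k - 1) - 4 * a 0 * a k"
    and rail: "\<And>k. k \<in> {1..8} \<Longrightarrow> X k = X (k - 1) \<or> Y k = Y (k - 1)"
  shows "\<exists>i<9. \<exists>j<9. a i - a j > 1 / 3500"
proof (rule ccontr)
  assume "\<not> ?thesis"
  then have osc: "a i - a j \<le> 1 / 3500" if "i < 9" "j < 9" for i j
    using that by (meson not_less)
  have XY: "X k * Y k = 1 - 4 * a 0 * sum a {1..k}" if "k \<le> 8" for k
    using that
  proof (induction k)
    case (Suc k)
    then show ?case using prod[of "Suc k"] by (simp add: algebra_simps)
  qed (simp add: init)
  \<comment> \<open>Two expressions for X 8 * Y 8 show that the nine areas sum to 1.\<close>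
  have "(1 - 2 * a 0) * (1 - 2 * a 0) = 1 - 4 * a 0 * sum a {1..8}"
    using XY[of 8] final by simp
  then have "4 * a 0 * sum a {1..8} = 4 * a 0 * (1 - a 0)"
    by (simp add: algebra_simps)
  then have total: "sum a {1..8} = 1 - a 0"
    using pos(3) by simp
  define \<delta> where "\<delta> i = a i - 1 / 9" for i
  have "{..<9} = insert 0 {1..8::nat}"
    by auto
  then have "sum a {..<9} = 1"
    using total by simp
  then interpret near_equal_areas \<delta>
    using osc by unfold_locales (simp_all add: \<delta>_def sum_subtractf)
  have rem: "remainder k = X k * Y k" if "k \<le> 8" for k
    using XY[OF that] by (simp add: remainder_def \<delta>_def sum_subtractf)
  define L where "L = {k \<in> {1..8}. X k \<noteq> X (k - 1)}"
  have "ln (X 8) = (\<Sum>k=1..8. ln (X k) - ln (X (k - 1)))"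
    using sum_telescope''[of 0 8 "\<lambda>k. ln (X k)"] init by simp
  also have "\<dots> = (\<Sum>k\<in>L. ln (X k) - ln (X (k - 1)))"
    by (intro sum.mono_neutral_right) (auto simp: L_def)
  \<comment> \<open>On a step in \<open>L\<close> the factor Y is constant, so ln X and ln (X Y)
    change alike.\<close>
  also have "\<dots> = (\<Sum>k\<in>L. ln (remainder k) - ln (remainder (k - 1)))"
  proof (intro sum.cong refl)
    fix k assume "k \<in> L"
    then have "k \<le> 8" "k - 1 \<le> 8" "Y k = Y (k - 1)"
      using rail by (auto simp: L_def)
    moreover from this have "0 < X k" "0 < X (k - 1)" "0 < Y (k - 1)"
      using pos by blast+
    ultimately show "ln (X k) - ln (X (k - 1)) = ln (remainder k) - ln (remainder (k - 1))"
      by (simp add: rem ln_mult)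
  qed
  finally have "(\<Sum>k\<in>L. ln (remainder k) - ln (remainder (k - 1))) = ln (7 / 9 - 2 * \<delta> 0)"
    by (simp add: final \<delta>_def)
  moreover have "L \<subseteq> {1..8}"
    by (auto simp: L_def)
  ultimately show False
    using log_sum_ne by blast
qed

theorem proposition4:
  fixes D :: "(real^2) set set"
  assumes "dissection 9 D"
    and "single_cap_two_rail 8 D"
  shows "area_range D > 1 / 3500"
proof -
  obtain g c s p u where g: "square_symmetry g" and c: "0 < c" "c < 1 / 2"
    and z: "zigzag c 8 s p u"
    and D: "D = (\<lambda>T. g ` T) ` insert (cap c) (zigzag_triangle s p u ` {1..8})"
    using assms(2) unfolding single_cap_two_rail_def by blast
  define T where "T k = (if k = 0 then cap c else zigzag_triangle s p u k)" for k :: nat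
  define a where "a k = measure lborel (T k)" for k
  have a0: "a 0 = c"
    using c area_cap[of c] by (simp add: a_def T_def)
  \<comment> \<open>The symmetry preserves areas, so they are computed in standard position.\<close>
  have T: "g ` T k \<in> D" "measure lborel (g ` T k) = a k" if "k < 9" for k
  proof -
    have "k = 0 \<or> k \<in> {1..8}"
      using that by auto
    then show "g ` T k \<in> D"
      by (auto simp: D T_def)
    have "compact (T k)"
      by (auto simp: T_def cap_def zigzag_triangle_def triangle_def
          intro!: finite_imp_compact_convex_hull)
    then show "measure lborel (g ` T k) = a k"
      using g unfolding a_def square_symmetry_def by (intro content_isometry_image) auto
  qed
  define X Y where "X k = 1 - 2 * c * p k $ 1" and "Y k = 1 - 2 * c * u k $ 1" for k
  have "\<exists>i<9. \<exists>j<9. a i - a j > 1 / 3500"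
  proof (rule two_rail_unequal_areas[where X = X and Y = Y])
    show "X 0 = 1" "Y 0 = 1" "X 8 = 1 - 2 * a 0" "Y 8 = 1 - 2 * a 0" "0 < a 0"
      using z c a0 by (simp_all add: zigzag_def X_def Y_def cap_vertex_def)
    show "0 < X k" "0 < Y k" if "k \<le> 8" for k
    proof -
      have "2 * c * p k $ 1 \<le> 2 * c * 1" "2 * c * u k $ 1 \<le> 2 * c * 1"
        using zigzag_coordinates[OF z that] c by (intro mult_left_mono; simp)+
      then show "0 < X k" "0 < Y k"
        using c unfolding X_def Y_def by linarith+
    qed
    fix k :: nat
    assume k: "k \<in> {1..8}"
    then have ak: "a k = measure lborel (zigzag_triangle s p u k)"
      by (simp add: a_def T_def)
    show "X k * Y k = X (k - 1) * Y (k - 1) - 4 * a 0 * a k"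
      unfolding X_def Y_def ak a0 by (rule zigzag_step(1)[OF z k c])
    show "X k = X (k - 1) \<or> Y k = Y (k - 1)"
      unfolding X_def Y_def by (rule zigzag_step(2)[OF z k c])
  qed
  then obtain i j where "i < 9" "j < 9" "1 / 3500 < a i - a j"
    by blast
  moreover have "finite D"
    by (simp add: D)
  ultimately show ?thesis
    using diff_le_area_range[of D "g ` T i" "g ` T j"] T by simp
qed

end
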